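(* Let $p\ge 1$ be a real number. Let $(\Omega,F,P)$ be a probability space, and let $X_1,X_2,\dots$ and $X_\infty$ be random variables $\Omega\to\mathbb{R}^{**}$ that are finite almost everywhere, i.e. $P(X_n\in\mathbb{R})=1$ for every $n\ge 1$ and $P(X_\infty\in\mathbb{R})=1$. Let $A=(a_{ij})$, $i=1,2,\dots$, $j=0,1,2,\dots$, be a double sequence of real constants such that: 1. $\sup_{1\le i<\infty}\sum_{j=0}^{\infty}|a_{ij}|=M<\infty$; 2. $\lim_{i\to\infty}a_{ij}=0$ for each $j=1,2,\dots$; 3. $\lim_{i\to\infty}\sum_{j=1}^{\infty}a_{ij}=1$. Write $(Ax)_n=\sum_{j=1}^{\infty}a_{nj}X_j$ for $n=1,2,\dots$. If $X_n\to X_\infty$ in $L^p(\Omega)$, then $(Ax)_n\to X_\infty$ in $L^p(\Omega)$.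
   Context: Extended real numbers $\mathbb{R}^{**}$: let $\mathbb{R}^{**}$ be a 2-dimensional real vector space with basis $(1,\infty)$, so every element is uniquely $u=a+b\cdot\infty$ with $a,b\in\mathbb{R}$; $\mathbb{R}$ is identified with $\{a\cdot 1: a\in\mathbb{R}\}$. It carries the lexicographic order: $a+b\cdot\infty<c+d\cdot\infty$ iff $b<d$, or $b=d$ and $a<c$. The absolute value is $|a+b\cdot\infty|:=|a|+|b|\cdot\infty$, which on $\mathbb{R}$ is the usual one. Elements of $\mathbb{R}^{**}\setminus\mathbb{R}$ are called infinite. Expectation: for a random variable $X:\Omega\to\mathbb{R}^{**}$ that is finite a.e., $E(X)=\int_\Omega X\,dP:=\int_{\{\omega:\,X(\omega)\in\mathbb{R}\}}X(\omega)\,P(d\omega)$. Convergence $X_n\to X_\infty$ in $L^p(\Omega)$ means that all $X_n$ and $X_\infty$ belong to $L^p(\Omega)$ and $(E|X_n-X_\infty|^p)^{1/p}\to 0$. Here $x=(X_1,X_2,\dots)$ is the sequence of random variables. Since countably many a.e. finite random variables are simultaneously finite on a set of probability one, the statement (and the values of $(Ax)_n$) is only concerned with a full-measure set on which all $X_n$ and $X_\infty$ are real-valued. What happens on a null set is irrelevant. *)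

theory Defs
  imports "HOL-Probability.Probability"
begin

text \<open>\<open>XReal a b\<close> stands for \<open>a + b \<cdot> \<infinity>\<close>.\<close>

datatype xreal = XReal (fin_part: real) (inf_part: real)

lemma xreal_eq_iff: "u = v \<longleftrightarrow> fin_part u = fin_part v \<and> inf_part u = inf_part v"
  by (cases u; cases v) simp

definition xreal_of_real :: "real \<Rightarrow> xreal" where
  "xreal_of_real a = XReal a 0"

definition finite_xreal :: "xreal \<Rightarrow> bool" where
  "finite_xreal u \<longleftrightarrow> u \<in> range xreal_of_real"

instantiation xreal :: real_vector
begin

definition zero_xreal :: xreal where
  "0 = XReal 0 0"

definition plus_xreal :: "xreal \<Rightarrow> xreal \<Rightarrow> xreal" where
  "u + v = XReal (fin_part u + fin_part v) (inf_part u + inf_part v)"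

definition minus_xreal :: "xreal \<Rightarrow> xreal \<Rightarrow> xreal" where
  "u - v = XReal (fin_part u - fin_part v) (inf_part u - inf_part v)"

definition uminus_xreal :: "xreal \<Rightarrow> xreal" where
  "- u = XReal (- fin_part u) (- inf_part u)"

definition scaleR_xreal :: "real \<Rightarrow> xreal \<Rightarrow> xreal" where
  "c *\<^sub>R u = XReal (c * fin_part u) (c * inf_part u)"

instance
  by standard
    (simp_all add: xreal_eq_iff zero_xreal_def plus_xreal_def minus_xreal_def
      uminus_xreal_def scaleR_xreal_def algebra_simps)

end

instantiation xreal :: linorder
begin

definition less_xreal :: "xreal \<Rightarrow> xreal \<Rightarrow> bool" where
  "u < v \<longleftrightarrow> inf_part u < inf_part v \<or> inf_part u = inf_part v \<and> fin_part u < fin_part v"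

definition less_eq_xreal :: "xreal \<Rightarrow> xreal \<Rightarrow> bool" where
  "u \<le> v \<longleftrightarrow> u < v \<or> u = (v :: xreal)"

instance
  by standard (auto simp: xreal_eq_iff less_xreal_def less_eq_xreal_def)

end

text \<open>This is not the order-theoretic absolute value \<open>max u (- u)\<close>.\<close>

instantiation xreal :: abs
begin

definition abs_xreal :: "xreal \<Rightarrow> xreal" where
  "\<bar>u\<bar> = XReal \<bar>fin_part u\<bar> \<bar>inf_part u\<bar>"

instance ..

end

text \<open>
  The topology is the canonical one of a two-dimensional real vector space; it is strictly coarser
  than the order topology of the lexicographic order, but both induce the usual topology on the
  finite elements.  For the Borel sets of this topology the measurable functions are closed under
  the vector space operations, which is not clear for those of the order topology.
\<close>

instantiation xreal :: t2_space
begin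

definition open_xreal :: "xreal set \<Rightarrow> bool" where
  "open U \<longleftrightarrow> open ((\<lambda>(a, b). XReal a b) -` U)"

instance
proof
  show "open (UNIV :: xreal set)"
    by (simp add: open_xreal_def)
next
  fix S T :: "xreal set"
  assume "open S" "open T"
  then show "open (S \<inter> T)"
    by (simp add: open_xreal_def vimage_Int open_Int)
next
  fix K :: "xreal set set"
  assume "\<forall>S\<in>K. open S"
  then show "open (\<Union>K)"
    by (auto simp: open_xreal_def vimage_Union)
next
  fix u v :: xreal
  assume "u \<noteq> v"
  then have "(fin_part u, inf_part u) \<noteq> (fin_part v, inf_part v)"
    by (auto simp: xreal_eq_iff)
  then obtain S T where ST: "open S" "open T" "(fin_part u, inf_part u) \<in> S"
      "(fin_part v, inf_part v) \<in> T" "S \<inter> T = {}"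
    by (meson hausdorff)
  let ?V = "\<lambda>S. (\<lambda>w. (fin_part w, inf_part w)) -` S"
  have vim: "(\<lambda>(a, b). XReal a b) -` ?V S = S" for S
    by auto
  have "open (?V S)" "open (?V T)" "u \<in> ?V S" "v \<in> ?V T" "?V S \<inter> ?V T = {}"
    using ST by (simp_all add: open_xreal_def vim) auto
  then show "\<exists>U V. open U \<and> open V \<and> u \<in> U \<and> v \<in> V \<and> U \<inter> V = {}"
    by blast
qed

end

text \<open>
  Only the powers of finite elements matter; an infinite element is left unchanged so that
  its power is again infinite.
\<close>

definition xpowr :: "xreal \<Rightarrow> real \<Rightarrow> xreal" where
  "xpowr u p = (if finite_xreal u then xreal_of_real (fin_part u powr p) else u)"

definition finite_on :: "'a measure \<Rightarrow> ('a \<Rightarrow> xreal) \<Rightarrow> 'a set" where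
  "finite_on M X = {\<omega> \<in> space M. finite_xreal (X \<omega>)}"

definition xintegrable :: "'a measure \<Rightarrow> ('a \<Rightarrow> xreal) \<Rightarrow> bool" where
  "xintegrable M X \<longleftrightarrow> set_integrable M (finite_on M X) (\<lambda>\<omega>. fin_part (X \<omega>))"

definition xexpectation :: "'a measure \<Rightarrow> ('a \<Rightarrow> xreal) \<Rightarrow> real" where
  "xexpectation M X = (LINT \<omega>:finite_on M X|M. fin_part (X \<omega>))"

definition in_Lp :: "'a measure \<Rightarrow> real \<Rightarrow> ('a \<Rightarrow> xreal) \<Rightarrow> bool" where
  "in_Lp M p X \<longleftrightarrow>
     X \<in> borel_measurable M \<and> (AE \<omega> in M. finite_xreal (X \<omega>)) \<and>
     xintegrable M (\<lambda>\<omega>. xpowr \<bar>X \<omega>\<bar> p)"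

text \<open>Sequences are indexed from 1; the value at index 0 is ignored.\<close>

definition converges_in_Lp ::
  "'a measure \<Rightarrow> real \<Rightarrow> (nat \<Rightarrow> 'a \<Rightarrow> xreal) \<Rightarrow> ('a \<Rightarrow> xreal) \<Rightarrow> bool" where
  "converges_in_Lp M p X Y \<longleftrightarrow>
     (\<forall>n\<ge>1. in_Lp M p (X n)) \<and> in_Lp M p Y \<and>
     (\<lambda>n. xexpectation M (\<lambda>\<omega>. xpowr \<bar>X n \<omega> - Y \<omega>\<bar> p) powr (1 / p)) \<longlonglongrightarrow> 0"

text \<open>
  The series over \<open>j \<ge> 1\<close>; the column \<open>j = 0\<close> of \<open>a\<close> does not enter.
\<close>

definition matrix_transform ::
  "(nat \<Rightarrow> nat \<Rightarrow> real) \<Rightarrow> (nat \<Rightarrow> 'a \<Rightarrow> xreal) \<Rightarrow> nat \<Rightarrow> 'a \<Rightarrow> xreal" where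
  "matrix_transform a X n \<omega> = (\<Sum>j. a n (Suc j) *\<^sub>R X (Suc j) \<omega>)"

end

theory Submission
  imports Defs
begin

text \<open>
  Write \<open>f\<^sub>j = X\<^sub>j - X\<^sub>\<infinity>\<close> and \<open>s\<^sub>n = \<Sum>\<^sub>j a\<^sub>n\<^sub>j\<close>. On the full-measure set where everything is finite
  and the series converge,
  \<open>(Ax)\<^sub>n - X\<^sub>\<infinity> = \<Sum>\<^sub>j a\<^sub>n\<^sub>j f\<^sub>j + (s\<^sub>n - 1) X\<^sub>\<infinity>\<close>. The second term tends to \<open>0\<close> in \<open>L\<^sup>p\<close> because
  \<open>s\<^sub>n \<longlonglongrightarrow> 1\<close>.

  For the first term it is convenient to estimate \<open>p\<close>-th moments instead of norms, as this replaces
  Minkowski's inequality for infinite series by a pointwise one. Convexity of \<open>t\<^sup>p\<close>, with the weights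
  \<open>\<bar>a\<^sub>n\<^sub>j\<bar>\<close> of total mass at most \<open>K\<close>, gives
  \<open>\<bar>\<Sum>\<^sub>j a\<^sub>n\<^sub>j f\<^sub>j\<bar>\<^sup>p \<le> K\<^sup>p\<^sup>-\<^sup>1 \<Sum>\<^sub>j \<bar>a\<^sub>n\<^sub>j\<bar> \<bar>f\<^sub>j\<bar>\<^sup>p\<close> (\<open>weighted_suminf_powr_le\<close>). Integrating term by
  term bounds the \<open>p\<close>-th moment by \<open>K\<^sup>p\<^sup>-\<^sup>1 \<Sum>\<^sub>j \<bar>a\<^sub>n\<^sub>j\<bar> E\<bar>f\<^sub>j\<bar>\<^sup>p\<close>
  (\<open>integral_powr_suminf_le\<close>), and the same monotone series shows that \<open>\<Sum>\<^sub>j a\<^sub>n\<^sub>j f\<^sub>j\<close> converges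
  absolutely almost everywhere. Since \<open>E\<bar>f\<^sub>j\<bar>\<^sup>p \<longlonglongrightarrow> 0\<close>, what remains is a Toeplitz transform of a
  real null sequence, and that is again a null sequence (\<open>Toeplitz_null\<close>).

  The passage between \<open>\<real>\<^sup>*\<^sup>*\<close>-valued and real-valued functions is coordinatewise: sums, limits and
  measurability can be read off from the two coordinates, and a random variable that is finite almost
  everywhere has the same moments as its finite part (\<open>converges_in_Lp_iff\<close>).
\<close>

section \<open>Inequalities for series\<close>

lemma powr_above_tangent:
  fixes x m p :: real
  assumes "p \<ge> 1" "x \<ge> 0" "m > 0"
  shows "m powr p + p * m powr (p - 1) * (x - m) \<le> x powr p"
proof (cases "x = 0")
  case True
  have "m powr (p - 1) * m = m powr p"
    using assms powr_mult_base[of m "p - 1"] by (simp add: mult.commute)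
  moreover have "m powr p \<le> p * m powr p"
    using assms by simp
  ultimately show ?thesis
    using True assms by (simp add: mult.assoc)
next
  case False
  then have "x > 0"
    using assms by simp
  have "p * m powr (p - 1) * (x - m) \<le> x powr p - m powr p"
  proof (rule convex_on_imp_above_tangent[where A = "{0<..}" and f = "\<lambda>x. x powr p"])
    show "convex_on {0<..} (\<lambda>x. x powr p)"
      using assms by (intro powr_convex)
    show "((\<lambda>x. x powr p) has_field_derivative p * m powr (p - 1)) (at m within {0<..})"
      using assms by (auto intro: has_field_derivative_at_within has_real_derivative_powr)
  qed (use assms \<open>x > 0\<close> in \<open>auto simp: interior_open\<close>)
  then show ?thesis
    by simp
qed

text \<open>
  Jensen's inequality for \<open>t\<^sup>p\<close> and infinitely many weights of arbitrary total mass. Summing the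
  tangent line inequality at the weighted mean avoids a passage to the limit from finite sums: the
  linear terms cancel. Convergence of the first moment comes for free from \<open>t \<le> 1 + t\<^sup>p\<close>.
\<close>

lemma
  fixes w x :: "nat \<Rightarrow> real"
  assumes p: "p \<ge> 1" and w: "\<And>j. w j \<ge> 0" and x: "\<And>j. x j \<ge> 0"
    and sw: "summable w" and swx: "summable (\<lambda>j. w j * x j powr p)"
  shows summable_weighted_if_powr: "summable (\<lambda>j. w j * x j)"
    and weighted_suminf_powr_le:
      "(\<Sum>j. w j * x j) powr p \<le> (\<Sum>j. w j) powr (p - 1) * (\<Sum>j. w j * x j powr p)"
proof -
  show sx: "summable (\<lambda>j. w j * x j)"
  proof (rule summable_comparison_test)
    show "summable (\<lambda>j. w j + w j * x j powr p)"
      by (intro summable_add sw swx)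
    have "x j \<le> 1 + x j powr p" for j
    proof (cases "x j \<le> 1")
      case False
      then show ?thesis
        using powr_mono[of 1 p "x j"] p by simp
    qed (simp add: add_increasing2)
    then have "w j * x j \<le> w j + w j * x j powr p" for j
      using mult_left_mono[OF _ w[of j]] by (fastforce simp: distrib_left)
    then show "\<exists>N. \<forall>j\<ge>N. norm (w j * x j) \<le> w j + w j * x j powr p"
      using w x by simp
  qed
  let ?A = "\<Sum>j. w j" and ?S = "\<Sum>j. w j * x j"
  have S0: "?S \<ge> 0" and A0: "?A \<ge> 0"
    using w x by (auto intro!: suminf_nonneg sx sw)
  show "?S powr p \<le> ?A powr (p - 1) * (\<Sum>j. w j * x j powr p)"
  proof (cases "?S = 0")
    case True
    then show ?thesis
      using w by (auto intro!: mult_nonneg_nonneg suminf_nonneg swx)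
  next
    case False
    with S0 have S: "?S > 0"
      by simp
    have "?A \<noteq> 0"
      using False suminf_eq_zero_iff[OF sw w] by auto
    with A0 have A: "?A > 0"
      by simp
    \<comment> \<open>the weighted mean of \<open>x\<close>\<close>
    define m where "m = ?S / ?A"
    have m: "m > 0" and S_eq: "?S = m * ?A"
      using S A by (simp_all add: m_def)
    have "w j * (m powr p) + p * m powr (p - 1) * (w j * x j - m * w j) \<le> w j * x j powr p" for j
      using mult_left_mono[OF powr_above_tangent[OF p x[of j] m] w[of j]]
      by (simp add: algebra_simps)
    then have "(\<Sum>j. w j * (m powr p) + p * m powr (p - 1) * (w j * x j - m * w j))
        \<le> (\<Sum>j. w j * x j powr p)"
      by (intro suminf_le swx summable_add summable_mult summable_mult2 summable_diff sx sw)
    also have "(\<Sum>j. w j * (m powr p) + p * m powr (p - 1) * (w j * x j - m * w j))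
        = ?A * m powr p + p * m powr (p - 1) * (?S - m * ?A)"
      by (simp add: suminf_add[symmetric] suminf_mult suminf_mult2[symmetric] suminf_diff[symmetric]
          summable_mult summable_mult2 summable_diff sx sw)
    finally have "?A * m powr p \<le> (\<Sum>j. w j * x j powr p)"
      by (simp add: S_eq)
    then have "?A powr (p - 1) * (?A * m powr p) \<le> ?A powr (p - 1) * (\<Sum>j. w j * x j powr p)"
      by (intro mult_left_mono) auto
    moreover have "?A powr (p - 1) * (?A * m powr p) = ?S powr p"
      using A m powr_mult_base[of ?A "p - 1"] by (simp add: S_eq powr_mult mult_ac)
    ultimately show ?thesis
      by simp
  qed
qed

text \<open>
  A crude constant is enough for \<open>L\<^sup>p\<close> to be closed under addition and for sums of null
  sequences in \<open>L\<^sup>p\<close> to be null.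
\<close>

lemma powr_add_le:
  fixes u v :: real
  assumes "p \<ge> 0"
  shows "\<bar>u + v\<bar> powr p \<le> 2 powr p * (\<bar>u\<bar> powr p + \<bar>v\<bar> powr p)"
proof -
  have "\<bar>u + v\<bar> powr p \<le> (2 * max \<bar>u\<bar> \<bar>v\<bar>) powr p"
    using assms by (intro powr_mono2) auto
  also have "\<dots> = 2 powr p * (max \<bar>u\<bar> \<bar>v\<bar>) powr p"
    by (simp add: powr_mult)
  also have "\<dots> \<le> 2 powr p * (\<bar>u\<bar> powr p + \<bar>v\<bar> powr p)"
    by (intro mult_left_mono) (auto simp: max_def)
  finally show ?thesis .
qed

text \<open>
  The null-sequence part of the Silverman-Toeplitz theorem. The terms before some \<open>N\<close> vanish in the
  limit because each of the finitely many columns does; beyond \<open>N\<close> the sequence is small and the rows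
  have bounded mass.
\<close>

lemma Toeplitz_null:
  fixes b :: "nat \<Rightarrow> nat \<Rightarrow> real" and e :: "nat \<Rightarrow> real"
  assumes sb: "\<forall>\<^sub>F n in sequentially. summable (\<lambda>j. \<bar>b n j\<bar>) \<and> (\<Sum>j. \<bar>b n j\<bar>) \<le> C"
    and col: "\<And>j. (\<lambda>n. b n j) \<longlonglongrightarrow> 0"
    and e: "e \<longlonglongrightarrow> 0"
  shows "(\<lambda>n. \<Sum>j. b n j * e j) \<longlonglongrightarrow> 0"
proof (rule LIMSEQ_I)
  fix r :: real
  assume r: "0 < r"
  \<comment> \<open>The summand \<open>1\<close> keeps the denominator positive when \<open>C = 0\<close>.\<close>
  define d where "d = r / (2 * (\<bar>C\<bar> + 1))"
  have d: "d > 0"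
    using r by (simp add: d_def)
  have Cd: "C * d < r / 2"
  proof -
    have "C * d < (\<bar>C\<bar> + 1) * d"
      using d by (intro mult_strict_right_mono) auto
    also have "\<dots> = r / 2"
      by (simp add: d_def field_simps)
    finally show ?thesis .
  qed
  obtain N where N: "\<And>j. j \<ge> N \<Longrightarrow> \<bar>e j\<bar> < d"
    using LIMSEQ_D[OF e d] by auto
  have "(\<lambda>n. \<Sum>j<N. b n j * e j) \<longlonglongrightarrow> (\<Sum>j<N. 0 * e j)"
    by (intro tendsto_intros col)
  from tendstoD[OF this, of "r / 2"] r
  have "\<forall>\<^sub>F n in sequentially. \<bar>\<Sum>j<N. b n j * e j\<bar> < r / 2"
    by (simp add: dist_real_def)
  then have "\<forall>\<^sub>F n in sequentially. norm ((\<Sum>j. b n j * e j) - 0) < r"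
    using sb
  proof eventually_elim
    case (elim n)
    then have s: "summable (\<lambda>j. \<bar>b n j\<bar>)" and C: "(\<Sum>j. \<bar>b n j\<bar>) \<le> C"
      by auto
    have sN: "summable (\<lambda>j. \<bar>b n (j + N)\<bar> * d)"
      by (intro summable_mult2 summable_ignore_initial_segment[OF s])
    have bound: "norm (b n (j + N) * e (j + N)) \<le> \<bar>b n (j + N)\<bar> * d" for j
      using N[of "j + N"] by (simp add: abs_mult mult_left_mono)
    then have st: "summable (\<lambda>j. norm (b n (j + N) * e (j + N)))"
      by (intro summable_comparison_test'[OF sN]) auto
    have sbe: "summable (\<lambda>j. b n j * e j)"
      using summable_norm_cancel[OF st] summable_iff_shift[of "\<lambda>j. b n j * e j" N] by simp
    have "\<bar>\<Sum>j. b n (j + N) * e (j + N)\<bar> \<le> (\<Sum>j. \<bar>b n (j + N)\<bar> * d)"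
      using summable_norm[OF st] suminf_le[OF bound st sN] by simp
    also have "\<dots> = (\<Sum>j. \<bar>b n (j + N)\<bar>) * d"
      by (simp add: suminf_mult2[symmetric] summable_ignore_initial_segment[OF s])
    also have "\<dots> \<le> C * d"
    proof -
      have "(\<Sum>j. \<bar>b n (j + N)\<bar>) \<le> (\<Sum>j. \<bar>b n j\<bar>)"
        using suminf_split_initial_segment[OF s, of N] by (simp add: sum_nonneg)
      then show ?thesis
        using C d by (intro mult_right_mono) auto
    qed
    finally have "\<bar>\<Sum>j. b n (j + N) * e (j + N)\<bar> < r / 2"
      using Cd by simp
    then show ?case
      using elim suminf_split_initial_segment[OF sbe, of N] by simp
  qed
  then show "\<exists>no. \<forall>n\<ge>no. norm ((\<Sum>j. b n j * e j) - 0) < r"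
    by (simp add: eventually_sequentially)
qed

section \<open>Series of functions with bounded moments\<close>

text \<open>
  The series \<open>\<Sum>\<^sub>j \<bar>w\<^sub>j\<bar> \<bar>f\<^sub>j\<bar>\<^sup>p\<close> has integrable sum, by monotone convergence and the bound on the moments.
  In particular it converges almost everywhere, and there the weighted Jensen inequality dominates
  \<open>\<bar>\<Sum>\<^sub>j w\<^sub>j f\<^sub>j\<bar>\<^sup>p\<close> by a multiple of it.
\<close>

lemma
  fixes w :: "nat \<Rightarrow> real" and f :: "nat \<Rightarrow> 'a \<Rightarrow> real"
  assumes p: "p \<ge> 1" and sw: "summable (\<lambda>j. \<bar>w j\<bar>)"
    and f [measurable]: "\<And>j. f j \<in> borel_measurable M"
    and int: "\<And>j. integrable M (\<lambda>\<omega>. \<bar>f j \<omega>\<bar> powr p)"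
    and bdd: "\<And>j. (\<integral>\<omega>. \<bar>f j \<omega>\<bar> powr p \<partial>M) \<le> B"
  shows AE_summable_of_bounded_moments: "AE \<omega> in M. summable (\<lambda>j. \<bar>w j * f j \<omega>\<bar>)"
    and integrable_powr_suminf: "integrable M (\<lambda>\<omega>. \<bar>\<Sum>j. w j * f j \<omega>\<bar> powr p)"
    and integral_powr_suminf_le:
      "(\<integral>\<omega>. \<bar>\<Sum>j. w j * f j \<omega>\<bar> powr p \<partial>M)
        \<le> (\<Sum>j. \<bar>w j\<bar>) powr (p - 1) * (\<Sum>j. \<bar>w j\<bar> * (\<integral>\<omega>. \<bar>f j \<omega>\<bar> powr p \<partial>M))"
proof -
  define h where "h j \<omega> = \<bar>w j\<bar> * \<bar>f j \<omega>\<bar> powr p" for j \<omega>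
  let ?A = "\<Sum>j. \<bar>w j\<bar>"
  have h_int: "integrable M (h j)" for j
    unfolding h_def by (intro integrable_mult_right int)
  have h_eq: "(\<integral>\<omega>. h j \<omega> \<partial>M) = \<bar>w j\<bar> * (\<integral>\<omega>. \<bar>f j \<omega>\<bar> powr p \<partial>M)" for j
    unfolding h_def by simp
  have h_nonneg: "h j \<omega> \<ge> 0" for j \<omega>
    by (simp add: h_def)
  have h_meas [measurable]: "h j \<in> borel_measurable M" for j
    using h_int by auto
  have sh: "summable (\<lambda>j. \<integral>\<omega>. h j \<omega> \<partial>M)"
  proof (rule summable_comparison_test')
    show "summable (\<lambda>j. \<bar>w j\<bar> * B)"
      by (intro summable_mult2 sw)
    show "norm (\<integral>\<omega>. h j \<omega> \<partial>M) \<le> \<bar>w j\<bar> * B" for j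
      using bdd[of j] by (simp add: h_eq abs_mult mult_left_mono)
  qed
  have "(\<integral>\<^sup>+\<omega>. (\<Sum>j. ennreal (h j \<omega>)) \<partial>M) = (\<Sum>j. \<integral>\<^sup>+\<omega>. ennreal (h j \<omega>) \<partial>M)"
    by (intro nn_integral_suminf) auto
  also have "\<dots> = (\<Sum>j. ennreal (\<integral>\<omega>. h j \<omega> \<partial>M))"
    by (simp add: nn_integral_eq_integral h_int h_nonneg)
  also have "\<dots> \<noteq> \<infinity>"
    using sh by (simp add: ennreal_suminf_neq_top h_nonneg)
  finally have "AE \<omega> in M. (\<Sum>j. ennreal (h j \<omega>)) \<noteq> \<infinity>"
    by (intro nn_integral_PInf_AE) auto
  then have AEh: "AE \<omega> in M. summable (\<lambda>j. h j \<omega>)"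
    by eventually_elim (auto intro!: summable_suminf_not_top h_nonneg)
  show AEs: "AE \<omega> in M. summable (\<lambda>j. \<bar>w j * f j \<omega>\<bar>)"
    using AEh
  proof eventually_elim
    case (elim \<omega>)
    then show ?case
      using summable_weighted_if_powr[OF p _ _ sw, of "\<lambda>j. \<bar>f j \<omega>\<bar>"] by (simp add: h_def abs_mult)
  qed
  have bound: "AE \<omega> in M. \<bar>\<Sum>j. w j * f j \<omega>\<bar> powr p \<le> ?A powr (p - 1) * (\<Sum>j. h j \<omega>)"
    using AEh AEs
  proof eventually_elim
    case (elim \<omega>)
    have "\<bar>\<Sum>j. w j * f j \<omega>\<bar> powr p \<le> (\<Sum>j. \<bar>w j * f j \<omega>\<bar>) powr p"
      using p summable_rabs[OF elim(2)] by (intro powr_mono2) auto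
    also have "\<dots> \<le> ?A powr (p - 1) * (\<Sum>j. h j \<omega>)"
      using weighted_suminf_powr_le[OF p _ _ sw, of "\<lambda>j. \<bar>f j \<omega>\<bar>"] elim(1)
      by (simp add: h_def abs_mult)
    finally show ?case .
  qed
  have AEh': "AE \<omega> in M. summable (\<lambda>j. norm (h j \<omega>))" and sh': "summable (\<lambda>j. \<integral>\<omega>. norm (h j \<omega>) \<partial>M)"
    using AEh sh by (simp_all add: h_nonneg)
  have Hint: "integrable M (\<lambda>\<omega>. ?A powr (p - 1) * (\<Sum>j. h j \<omega>))"
    by (intro integrable_mult_right integrable_suminf h_int AEh' sh')
  show *: "integrable M (\<lambda>\<omega>. \<bar>\<Sum>j. w j * f j \<omega>\<bar> powr p)"
    by (rule Bochner_Integration.integrable_bound[OF Hint]) (use bound in auto)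
  have "(\<integral>\<omega>. \<bar>\<Sum>j. w j * f j \<omega>\<bar> powr p \<partial>M) \<le> (\<integral>\<omega>. ?A powr (p - 1) * (\<Sum>j. h j \<omega>) \<partial>M)"
    by (intro integral_mono_AE * Hint bound)
  also have "\<dots> = ?A powr (p - 1) * (\<Sum>j. \<bar>w j\<bar> * (\<integral>\<omega>. \<bar>f j \<omega>\<bar> powr p \<partial>M))"
    using integral_suminf[OF h_int AEh' sh'] by (simp add: h_eq)
  finally show "(\<integral>\<omega>. \<bar>\<Sum>j. w j * f j \<omega>\<bar> powr p \<partial>M)
      \<le> ?A powr (p - 1) * (\<Sum>j. \<bar>w j\<bar> * (\<integral>\<omega>. \<bar>f j \<omega>\<bar> powr p \<partial>M))" .
qed

section \<open>Extended reals as pairs of reals\<close>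

lemma finite_xreal_iff: "finite_xreal u \<longleftrightarrow> inf_part u = 0"
  by (cases u) (auto simp: finite_xreal_def xreal_of_real_def)

lemma xreal_simps [simp]:
  "fin_part (c *\<^sub>R u) = c * fin_part u" "inf_part (c *\<^sub>R u) = c * inf_part u"
  "fin_part (u - v) = fin_part u - fin_part v" "inf_part (u - v) = inf_part u - inf_part v"
  "fin_part \<bar>u\<bar> = \<bar>fin_part u\<bar>" "inf_part \<bar>u\<bar> = \<bar>inf_part u\<bar>"
  by (simp_all add: scaleR_xreal_def minus_xreal_def abs_xreal_def)

lemma xreal_sum_parts:
  "fin_part (\<Sum>j\<in>I. f j) = (\<Sum>j\<in>I. fin_part (f j))"
  "inf_part (\<Sum>j\<in>I. f j) = (\<Sum>j\<in>I. inf_part (f j))"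
  by (induction I rule: infinite_finite_induct) (simp_all add: zero_xreal_def plus_xreal_def)

lemma continuous_xreal_pair: "continuous_on UNIV (\<lambda>(a, b). XReal a b)"
  by (simp add: continuous_on_open_vimage open_xreal_def)

lemma continuous_xreal_parts: "continuous_on UNIV fin_part" "continuous_on UNIV inf_part"
proof -
  have "(\<lambda>(a, b). XReal a b) -` fin_part -` B = B \<times> UNIV"
    "(\<lambda>(a, b). XReal a b) -` inf_part -` B = UNIV \<times> B" for B
    by auto
  then show "continuous_on UNIV fin_part" "continuous_on UNIV inf_part"
    by (auto simp: continuous_on_open_vimage open_xreal_def open_Times)
qed

lemma borel_measurable_xreal_parts [measurable]:
  "fin_part \<in> borel_measurable borel" "inf_part \<in> borel_measurable borel"
  by (intro borel_measurable_continuous_onI continuous_xreal_parts)+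

lemma borel_measurable_XReal [measurable (raw)]:
  assumes [measurable]: "f \<in> borel_measurable M" "g \<in> borel_measurable M"
  shows "(\<lambda>\<omega>. XReal (f \<omega>) (g \<omega>)) \<in> borel_measurable M"
proof -
  have "(\<lambda>\<omega>. case (f \<omega>, g \<omega>) of (a, b) \<Rightarrow> XReal a b) \<in> borel_measurable M"
    by (rule measurable_compose[OF _ borel_measurable_continuous_onI[OF continuous_xreal_pair]])
      measurable
  then show ?thesis
    by simp
qed

lemma xreal_sums_iff:
  "f sums s \<longleftrightarrow>
    (\<lambda>j. fin_part (f j)) sums fin_part s \<and> (\<lambda>j. inf_part (f j)) sums inf_part s"
proof (intro iffI conjI)
  assume "f sums s"
  then show "(\<lambda>j. fin_part (f j)) sums fin_part s" "(\<lambda>j. inf_part (f j)) sums inf_part s"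
    unfolding sums_def xreal_sum_parts[symmetric]
    using continuous_on_tendsto_compose[OF continuous_xreal_parts(1)]
      continuous_on_tendsto_compose[OF continuous_xreal_parts(2)] by auto
next
  assume "(\<lambda>j. fin_part (f j)) sums fin_part s \<and> (\<lambda>j. inf_part (f j)) sums inf_part s"
  then have "(\<lambda>n. (fin_part (\<Sum>j<n. f j), inf_part (\<Sum>j<n. f j))) \<longlonglongrightarrow> (fin_part s, inf_part s)"
    unfolding sums_def xreal_sum_parts by (intro tendsto_Pair) auto
  from continuous_on_tendsto_compose[OF continuous_xreal_pair this] show "f sums s"
    by (simp add: sums_def)
qed

lemma xreal_sums_suminf:
  assumes "summable (\<lambda>j. fin_part (f j))" "summable (\<lambda>j. inf_part (f j))"
  shows "f sums XReal (\<Sum>j. fin_part (f j)) (\<Sum>j. inf_part (f j))"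
  using assms by (simp add: xreal_sums_iff summable_sums)

lemma xreal_summable_iff:
  "summable f \<longleftrightarrow> summable (\<lambda>j. fin_part (f j)) \<and> summable (\<lambda>j. inf_part (f j))"
proof
  assume "summable f"
  then obtain s where "f sums s"
    by (auto simp: summable_def)
  then show "summable (\<lambda>j. fin_part (f j)) \<and> summable (\<lambda>j. inf_part (f j))"
    unfolding xreal_sums_iff by (blast intro: sums_summable)
qed (blast intro: xreal_sums_suminf sums_summable)

text \<open>
  The sum has to be measurable also where the series diverges. There \<open>suminf\<close> is an unspecified
  but fixed element, so the sum is defined by two cases, split along the measurable set where both
  coordinate series are Cauchy.
\<close>

lemma borel_measurable_xreal_suminf:
  fixes f :: "nat \<Rightarrow> 'a \<Rightarrow> xreal"
  assumes [measurable]: "\<And>j. f j \<in> borel_measurable M"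
  shows "(\<lambda>\<omega>. \<Sum>j. f j \<omega>) \<in> borel_measurable M"
proof -
  have "(\<Sum>j. f j \<omega>) =
      (if Cauchy (\<lambda>n. \<Sum>j<n. fin_part (f j \<omega>)) \<and> Cauchy (\<lambda>n. \<Sum>j<n. inf_part (f j \<omega>))
       then XReal (\<Sum>j. fin_part (f j \<omega>)) (\<Sum>j. inf_part (f j \<omega>)) else (THE s. False))" for \<omega>
  proof (cases "summable (\<lambda>j. f j \<omega>)")
    case True
    then show ?thesis
      using xreal_sums_suminf[of "\<lambda>j. f j \<omega>"]
      by (simp add: xreal_summable_iff summable_iff_convergent Cauchy_convergent_iff sums_unique[symmetric])
  next
    case False
    then have "(\<Sum>j. f j \<omega>) = (THE s. False)"
      by (auto simp: suminf_def summable_def)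
    with False show ?thesis
      by (auto simp: xreal_summable_iff summable_iff_convergent Cauchy_convergent_iff)
  qed
  then show ?thesis
    by (simp cong: measurable_cong)
qed

section \<open>Moments of extended real random variables\<close>

text \<open>
  The integrand that defines a moment vanishes where \<open>Z\<close> is infinite, so it differs from the power of
  the finite part only on a null set.
\<close>

lemma
  assumes Z [measurable]: "Z \<in> borel_measurable M" and fin: "AE \<omega> in M. finite_xreal (Z \<omega>)"
  shows xintegrable_xpowr_abs_iff:
      "xintegrable M (\<lambda>\<omega>. xpowr \<bar>Z \<omega>\<bar> p) \<longleftrightarrow> integrable M (\<lambda>\<omega>. \<bar>fin_part (Z \<omega>)\<bar> powr p)"
    and xexpectation_xpowr_abs:
      "xexpectation M (\<lambda>\<omega>. xpowr \<bar>Z \<omega>\<bar> p) = (\<integral>\<omega>. \<bar>fin_part (Z \<omega>)\<bar> powr p \<partial>M)"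
proof -
  let ?F = "finite_on M (\<lambda>\<omega>. xpowr \<bar>Z \<omega>\<bar> p)"
  have F: "?F = {\<omega> \<in> space M. inf_part (Z \<omega>) = 0}"
    by (auto simp: finite_on_def finite_xreal_iff xpowr_def xreal_of_real_def)
  have eq: "indicat_real ?F \<omega> *\<^sub>R fin_part (xpowr \<bar>Z \<omega>\<bar> p)
      = (if \<omega> \<in> space M \<and> inf_part (Z \<omega>) = 0 then \<bar>fin_part (Z \<omega>)\<bar> powr p else 0)" for \<omega>
    unfolding F by (auto simp: xpowr_def finite_xreal_iff xreal_of_real_def)
  have AEeq: "AE \<omega> in M. indicat_real ?F \<omega> *\<^sub>R fin_part (xpowr \<bar>Z \<omega>\<bar> p) = \<bar>fin_part (Z \<omega>)\<bar> powr p"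
    using fin AE_space unfolding eq by eventually_elim (simp add: finite_xreal_iff)
  have meas: "(\<lambda>\<omega>. indicat_real ?F \<omega> *\<^sub>R fin_part (xpowr \<bar>Z \<omega>\<bar> p)) \<in> borel_measurable M"
    unfolding eq by measurable
  show "xintegrable M (\<lambda>\<omega>. xpowr \<bar>Z \<omega>\<bar> p) \<longleftrightarrow> integrable M (\<lambda>\<omega>. \<bar>fin_part (Z \<omega>)\<bar> powr p)"
    unfolding xintegrable_def set_integrable_def
    by (intro integrable_cong_AE meas AEeq) measurable
  show "xexpectation M (\<lambda>\<omega>. xpowr \<bar>Z \<omega>\<bar> p) = (\<integral>\<omega>. \<bar>fin_part (Z \<omega>)\<bar> powr p \<partial>M)"
    unfolding xexpectation_def set_lebesgue_integral_def
    by (intro integral_cong_AE meas AEeq) measurable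
qed

lemma in_Lp_iff:
  "in_Lp M p Z \<longleftrightarrow> Z \<in> borel_measurable M \<and> (AE \<omega> in M. finite_xreal (Z \<omega>)) \<and>
    integrable M (\<lambda>\<omega>. \<bar>fin_part (Z \<omega>)\<bar> powr p)"
  unfolding in_Lp_def using xintegrable_xpowr_abs_iff by blast

lemma borel_measurable_xreal_diff:
  fixes Y Z :: "'a \<Rightarrow> xreal"
  assumes [measurable]: "Y \<in> borel_measurable M" "Z \<in> borel_measurable M"
  shows "(\<lambda>\<omega>. Y \<omega> - Z \<omega>) \<in> borel_measurable M"
  unfolding minus_xreal_def by measurable

lemma borel_measurable_xreal_scaleR:
  fixes Z :: "'a \<Rightarrow> xreal"
  assumes [measurable]: "Z \<in> borel_measurable M"
  shows "(\<lambda>\<omega>. c *\<^sub>R Z \<omega>) \<in> borel_measurable M"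
  unfolding scaleR_xreal_def by measurable

lemma xexpectation_diff_in_Lp:
  assumes "in_Lp M p Y" "in_Lp M p Z"
  shows "xexpectation M (\<lambda>\<omega>. xpowr \<bar>Y \<omega> - Z \<omega>\<bar> p)
    = (\<integral>\<omega>. \<bar>fin_part (Y \<omega>) - fin_part (Z \<omega>)\<bar> powr p \<partial>M)"
proof -
  have "AE \<omega> in M. finite_xreal (Y \<omega>)" "AE \<omega> in M. finite_xreal (Z \<omega>)"
    using assms by (simp_all add: in_Lp_iff)
  then have "AE \<omega> in M. finite_xreal (Y \<omega> - Z \<omega>)"
    by eventually_elim (simp add: finite_xreal_iff)
  then show ?thesis
    using xexpectation_xpowr_abs[of "\<lambda>\<omega>. Y \<omega> - Z \<omega>" M p] assms
    by (simp add: in_Lp_iff borel_measurable_xreal_diff)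
qed

lemma integrable_powr_add:
  fixes f g :: "'a \<Rightarrow> real"
  assumes p: "p \<ge> 0" and [measurable]: "f \<in> borel_measurable M" "g \<in> borel_measurable M"
    and f: "integrable M (\<lambda>\<omega>. \<bar>f \<omega>\<bar> powr p)" and g: "integrable M (\<lambda>\<omega>. \<bar>g \<omega>\<bar> powr p)"
  shows "integrable M (\<lambda>\<omega>. \<bar>f \<omega> + g \<omega>\<bar> powr p)"
  by (rule Bochner_Integration.integrable_bound
      [OF integrable_mult_right[OF Bochner_Integration.integrable_add[OF f g], of "2 powr p"]])
    (use powr_add_le[OF p] in auto)

lemma tendsto_powr_inverse_0_iff:
  fixes I :: "nat \<Rightarrow> real"
  assumes "p > 0" and nonneg: "\<And>n. I n \<ge> 0"
  shows "(\<lambda>n. I n powr (1 / p)) \<longlonglongrightarrow> 0 \<longleftrightarrow> I \<longlonglongrightarrow> 0"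
proof
  assume "I \<longlonglongrightarrow> 0"
  then have "(\<lambda>n. I n powr (1 / p)) \<longlonglongrightarrow> 0 powr (1 / p)"
    using assms by (intro tendsto_powr') auto
  then show "(\<lambda>n. I n powr (1 / p)) \<longlonglongrightarrow> 0"
    by simp
next
  assume "(\<lambda>n. I n powr (1 / p)) \<longlonglongrightarrow> 0"
  then have "(\<lambda>n. (I n powr (1 / p)) powr p) \<longlonglongrightarrow> 0 powr p"
    using assms by (intro tendsto_powr') auto
  then show "I \<longlonglongrightarrow> 0"
    using assms by (simp add: powr_powr)
qed

text \<open>
  The root in the \<open>L\<^sup>p\<close> norm does not affect convergence to \<open>0\<close>. Moments of the differences are read off
  from index \<open>1\<close> on, because the variable at index \<open>0\<close> is arbitrary.
\<close>

lemma converges_in_Lp_iff: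
  assumes "p \<ge> 1"
  shows "converges_in_Lp M p X Y \<longleftrightarrow> (\<forall>n\<ge>1. in_Lp M p (X n)) \<and> in_Lp M p Y \<and>
    (\<lambda>n. \<integral>\<omega>. \<bar>fin_part (X (Suc n) \<omega>) - fin_part (Y \<omega>)\<bar> powr p \<partial>M) \<longlonglongrightarrow> 0"
proof -
  let ?E = "\<lambda>n. xexpectation M (\<lambda>\<omega>. xpowr \<bar>X n \<omega> - Y \<omega>\<bar> p)"
  have "(\<lambda>n. ?E n powr (1 / p)) \<longlonglongrightarrow> 0 \<longleftrightarrow>
      (\<lambda>n. \<integral>\<omega>. \<bar>fin_part (X (Suc n) \<omega>) - fin_part (Y \<omega>)\<bar> powr p \<partial>M) \<longlonglongrightarrow> 0"
    if "\<forall>n\<ge>1. in_Lp M p (X n)" "in_Lp M p Y"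
  proof -
    have "?E (Suc n) = (\<integral>\<omega>. \<bar>fin_part (X (Suc n) \<omega>) - fin_part (Y \<omega>)\<bar> powr p \<partial>M)" for n
      using that by (intro xexpectation_diff_in_Lp) auto
    then show ?thesis
      using filterlim_sequentially_Suc[of "\<lambda>n. ?E n powr (1 / p)" "nhds 0"] assms
      by (simp add: tendsto_powr_inverse_0_iff)
  qed
  then show ?thesis
    unfolding converges_in_Lp_def by blast
qed

section \<open>Matrix transforms\<close>

text \<open>
  The bound on the rows includes the entry in column \<open>0\<close>; dropping it only decreases the row sum.
\<close>

lemma
  fixes a :: "nat \<Rightarrow> nat \<Rightarrow> real"
  assumes "(SUP i\<in>{1..}. \<Sum>j. ennreal \<bar>a i j\<bar>) = K" "K < \<infinity>" "n \<ge> 1"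
  shows summable_row: "summable (\<lambda>j. \<bar>a n (Suc j)\<bar>)"
    and suminf_row_le: "(\<Sum>j. \<bar>a n (Suc j)\<bar>) \<le> enn2real K"
proof -
  have le: "(\<Sum>j. ennreal \<bar>a n j\<bar>) \<le> K"
    using assms by (auto intro!: SUP_upper)
  then have s: "summable (\<lambda>j. \<bar>a n j\<bar>)"
    using assms by (intro summable_suminf_not_top) (auto simp: top_unique)
  then show "summable (\<lambda>j. \<bar>a n (Suc j)\<bar>)"
    using summable_Suc_iff[of "\<lambda>j. \<bar>a n j\<bar>"] by simp
  have "(\<Sum>j. \<bar>a n (Suc j)\<bar>) \<le> (\<Sum>j. \<bar>a n j\<bar>)"
    using suminf_split_head[OF s] by simp
  also have "\<dots> = enn2real (\<Sum>j. ennreal \<bar>a n j\<bar>)"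
    using s by (simp add: suminf_ennreal2 suminf_nonneg)
  also have "\<dots> \<le> enn2real K"
    using assms(2) by (intro enn2real_mono[OF le]) simp
  finally show "(\<Sum>j. \<bar>a n (Suc j)\<bar>) \<le> enn2real K" .
qed

theorem proposition3p4:
  fixes P :: "'a measure" and p :: real and K :: ennreal
    and X :: "nat \<Rightarrow> 'a \<Rightarrow> xreal" and X_inf :: "'a \<Rightarrow> xreal"
    and a :: "nat \<Rightarrow> nat \<Rightarrow> real"
  assumes "p \<ge> 1"
    and "prob_space P"
    and "\<And>n. n \<ge> 1 \<Longrightarrow> X n \<in> borel_measurable P"
    and "X_inf \<in> borel_measurable P"
    and "\<And>n. n \<ge> 1 \<Longrightarrow> AE \<omega> in P. finite_xreal (X n \<omega>)"
    and "AE \<omega> in P. finite_xreal (X_inf \<omega>)"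
    and "(SUP i\<in>{1..}. \<Sum>j. ennreal \<bar>a i j\<bar>) = K" and "K < \<infinity>"
    and "\<And>j. j \<ge> 1 \<Longrightarrow> (\<lambda>i. a i j) \<longlonglongrightarrow> 0"
    and "(\<lambda>i. \<Sum>j. a i (Suc j)) \<longlonglongrightarrow> 1"
    and "converges_in_Lp P p X X_inf"
  shows "(\<forall>n\<ge>1. AE \<omega> in P. summable (\<lambda>j. a n (Suc j) *\<^sub>R X (Suc j) \<omega>)) \<and>
         converges_in_Lp P p (matrix_transform a X) X_inf"
proof -
  define x where "x \<omega> = fin_part (X_inf \<omega>)" for \<omega>
  define f where "f j \<omega> = fin_part (X (Suc j) \<omega>) - x \<omega>" for j \<omega>
  define e where "e j = (\<integral>\<omega>. \<bar>f j \<omega>\<bar> powr p \<partial>P)" for j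
  define C where "C = enn2real K"
  define s where "s n = (\<Sum>j. a n (Suc j))" for n
  define g where "g n \<omega> = (\<Sum>j. a n (Suc j) * f j \<omega>)" for n \<omega>
  let ?E = "\<integral>\<omega>. \<bar>x \<omega>\<bar> powr p \<partial>P"
  note p = \<open>p \<ge> 1\<close>
  have LpX: "\<And>j. in_Lp P p (X (Suc j))"
    and LpX_inf: "in_Lp P p X_inf" and e: "e \<longlonglongrightarrow> 0"
    using \<open>converges_in_Lp P p X X_inf\<close>
    unfolding converges_in_Lp_iff[OF p] e_def f_def x_def by auto
  have [measurable]: "X (Suc j) \<in> borel_measurable P" "X_inf \<in> borel_measurable P" for j
    using assms by auto
  have [measurable]: "x \<in> borel_measurable P"
    unfolding x_def by measurable
  have f_meas [measurable]: "f j \<in> borel_measurable P" for j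
    unfolding f_def by measurable
  have [measurable]: "g n \<in> borel_measurable P" for n
    unfolding g_def by measurable
  have x_int: "integrable P (\<lambda>\<omega>. \<bar>c * x \<omega>\<bar> powr p)" for c
    using LpX_inf by (simp add: in_Lp_iff x_def abs_mult powr_mult)
  have f_int: "integrable P (\<lambda>\<omega>. \<bar>f j \<omega>\<bar> powr p)" for j
    using integrable_powr_add[of p "\<lambda>\<omega>. fin_part (X (Suc j) \<omega>)" P "\<lambda>\<omega>. (-1) * x \<omega>"] p x_int[of "-1"]
      LpX[of j] by (simp add: in_Lp_iff f_def)
  obtain B where B: "e j \<le> B" for j
    using convergent_imp_Bseq[OF convergentI[OF e]]
    by (metis BseqE abs_le_D1 real_norm_def)
  note moment_le = B[unfolded e_def]
  note row = summable_row[OF assms(7,8)] suminf_row_le[OF assms(7,8), folded C_def]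
  have AEs: "AE \<omega> in P. summable (\<lambda>j. \<bar>a n (Suc j) * f j \<omega>\<bar>)" if "n \<ge> 1" for n
    by (rule AE_summable_of_bounded_moments[where B = B])
        (fact p row(1)[OF that] f_meas f_int moment_le)+
  have g_int: "integrable P (\<lambda>\<omega>. \<bar>g n \<omega>\<bar> powr p)" if "n \<ge> 1" for n
    unfolding g_def
    by (rule integrable_powr_suminf[where B = B])
        (fact p row(1)[OF that] f_meas f_int moment_le)+
  have g_le: "(\<integral>\<omega>. \<bar>g n \<omega>\<bar> powr p \<partial>P) \<le> C powr (p - 1) * (\<Sum>j. \<bar>a n (Suc j)\<bar> * e j)"
    if "n \<ge> 1" for n
  proof -
    have e0: "e j \<ge> 0" for j
      by (simp add: e_def)
    have "summable (\<lambda>j. \<bar>a n (Suc j)\<bar> * e j)"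
      by (rule summable_comparison_test'[OF summable_mult2[OF row(1)[OF that], of B]])
        (use B e0 in \<open>auto simp: abs_mult intro!: mult_left_mono\<close>)
    then have "0 \<le> (\<Sum>j. \<bar>a n (Suc j)\<bar> * e j)"
      using e0 by (intro suminf_nonneg) auto
    moreover have "(\<Sum>j. \<bar>a n (Suc j)\<bar>) powr (p - 1) \<le> C powr (p - 1)"
      using p row that by (intro powr_mono2 suminf_nonneg) auto
    moreover have "(\<integral>\<omega>. \<bar>g n \<omega>\<bar> powr p \<partial>P)
        \<le> (\<Sum>j. \<bar>a n (Suc j)\<bar>) powr (p - 1) * (\<Sum>j. \<bar>a n (Suc j)\<bar> * e j)"
      unfolding g_def e_def
      by (rule integral_powr_suminf_le[where B = B])
        (fact p row(1)[OF that] f_meas f_int moment_le)+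
    ultimately show ?thesis
      by (meson mult_right_mono order_trans)
  qed
  \<comment> \<open>Substituting \<open>X\<^sub>j = f\<^sub>j + X\<^sub>\<infinity>\<close> splits the transform into two convergent real series.\<close>
  have sums: "AE \<omega> in P. (\<lambda>j. a n (Suc j) *\<^sub>R X (Suc j) \<omega>) sums XReal (g n \<omega> + s n * x \<omega>) 0"
    if n: "n \<ge> 1" for n
  proof -
    have "AE \<omega> in P. \<forall>j. finite_xreal (X (Suc j) \<omega>)"
      using assms(5) by (auto simp: AE_all_countable)
    then show ?thesis
      using AEs[OF n]
    proof eventually_elim
      case (elim \<omega>)
      have "(\<lambda>j. a n (Suc j) * f j \<omega> + a n (Suc j) * x \<omega>) sums (g n \<omega> + s n * x \<omega>)"
        unfolding g_def s_def
        using summable_rabs_cancel[OF elim(2)] summable_rabs_cancel[OF row(1)[OF n]]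
        by (intro sums_add sums_mult2 summable_sums)
      then show ?case
        using elim(1) by (simp add: xreal_sums_iff finite_xreal_iff f_def algebra_simps)
    qed
  qed
  have MT: "AE \<omega> in P. matrix_transform a X n \<omega> = XReal (g n \<omega> + s n * x \<omega>) 0"
    if "n \<ge> 1" for n
    using sums[OF that] by eventually_elim (simp add: matrix_transform_def sums_unique[symmetric])
  have MT_meas [measurable]: "matrix_transform a X n \<in> borel_measurable P" for n
    unfolding matrix_transform_def[abs_def]
    by (intro borel_measurable_xreal_suminf borel_measurable_xreal_scaleR) measurable
  have sum_int: "integrable P (\<lambda>\<omega>. \<bar>g n \<omega> + c * x \<omega>\<bar> powr p)" if "n \<ge> 1" for n c
    using p by (intro integrable_powr_add g_int[OF that] x_int) auto
  have LpMT: "in_Lp P p (matrix_transform a X n)" if "n \<ge> 1" for n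
  proof -
    have "AE \<omega> in P. finite_xreal (matrix_transform a X n \<omega>)"
      using MT[OF that] by eventually_elim (simp add: finite_xreal_iff)
    moreover have "integrable P (\<lambda>\<omega>. \<bar>fin_part (matrix_transform a X n \<omega>)\<bar> powr p)"
      by (rule integrable_cong_AE_imp[OF sum_int[OF that, of "s n"]])
        (use MT[OF that] in auto)
    ultimately show ?thesis
      by (simp add: in_Lp_iff)
  qed
  let ?I = "\<lambda>n. \<integral>\<omega>. \<bar>fin_part (matrix_transform a X n \<omega>) - x \<omega>\<bar> powr p \<partial>P"
  let ?U = "\<lambda>n. 2 powr p * (C powr (p - 1) * (\<Sum>j. \<bar>a n (Suc j)\<bar> * e j) + \<bar>s n - 1\<bar> powr p * ?E)"
  have I_le: "?I n \<le> ?U n" if n: "n \<ge> 1" for n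
  proof -
    have "AE \<omega> in P. \<bar>fin_part (matrix_transform a X n \<omega>) - x \<omega>\<bar> powr p
        = \<bar>g n \<omega> + (s n - 1) * x \<omega>\<bar> powr p"
      using MT[OF n] by eventually_elim (simp add: algebra_simps)
    then have "?I n = (\<integral>\<omega>. \<bar>g n \<omega> + (s n - 1) * x \<omega>\<bar> powr p \<partial>P)"
      by (intro integral_cong_AE) auto
    also have "\<dots> \<le> (\<integral>\<omega>. 2 powr p * (\<bar>g n \<omega>\<bar> powr p + \<bar>(s n - 1) * x \<omega>\<bar> powr p) \<partial>P)"
      using p by (intro integral_mono sum_int n integrable_mult_right
          Bochner_Integration.integrable_add g_int x_int powr_add_le) auto
    also have "\<dots> = 2 powr p * ((\<integral>\<omega>. \<bar>g n \<omega>\<bar> powr p \<partial>P) + (\<integral>\<omega>. \<bar>(s n - 1) * x \<omega>\<bar> powr p \<partial>P))"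
      using Bochner_Integration.integral_add[OF g_int[OF n] x_int[of "s n - 1"]] by simp
    also have "(\<integral>\<omega>. \<bar>(s n - 1) * x \<omega>\<bar> powr p \<partial>P) = \<bar>s n - 1\<bar> powr p * ?E"
      by (simp add: abs_mult powr_mult)
    also have "2 powr p * ((\<integral>\<omega>. \<bar>g n \<omega>\<bar> powr p \<partial>P) + \<bar>s n - 1\<bar> powr p * ?E) \<le> ?U n"
      by (intro mult_left_mono add_right_mono g_le n) auto
    finally show ?thesis .
  qed
  have "(\<lambda>n. \<Sum>j. \<bar>a n (Suc j)\<bar> * e j) \<longlonglongrightarrow> 0"
  proof (rule Toeplitz_null[OF _ _ e])
    show "\<forall>\<^sub>F n in sequentially. summable (\<lambda>j. \<bar>\<bar>a n (Suc j)\<bar>\<bar>) \<and> (\<Sum>j. \<bar>\<bar>a n (Suc j)\<bar>\<bar>) \<le> C"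
      using eventually_ge_at_top[of 1] by eventually_elim (use row in auto)
    show "(\<lambda>n. \<bar>a n (Suc j)\<bar>) \<longlonglongrightarrow> 0" for j
      using assms(9)[of "Suc j"] by (intro tendsto_rabs_zero) auto
  qed
  moreover have "(\<lambda>n. \<bar>s n - 1\<bar> powr p) \<longlonglongrightarrow> 0"
  proof -
    have "(\<lambda>n. \<bar>s n - 1\<bar> powr p) \<longlonglongrightarrow> \<bar>1 - 1\<bar> powr p"
      using assms(10) p unfolding s_def by (intro tendsto_intros) auto
    then show ?thesis
      by simp
  qed
  ultimately have "?U \<longlonglongrightarrow> 2 powr p * (C powr (p - 1) * 0 + 0 * ?E)"
    by (intro tendsto_intros)
  then have U: "?U \<longlonglongrightarrow> 0"
    by simp
  have I: "?I \<longlonglongrightarrow> 0"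
  proof (rule tendsto_sandwich[OF _ _ tendsto_const U])
    show "\<forall>\<^sub>F n in sequentially. ?I n \<le> ?U n"
      using eventually_ge_at_top[of 1] by eventually_elim (rule I_le)
  qed simp
  have "converges_in_Lp P p (matrix_transform a X) X_inf"
    unfolding converges_in_Lp_iff[OF p]
    using LpMT LpX_inf LIMSEQ_Suc[OF I] by (auto simp: x_def)
  moreover have "AE \<omega> in P. summable (\<lambda>j. a n (Suc j) *\<^sub>R X (Suc j) \<omega>)" if "n \<ge> 1" for n
    using sums[OF that] by eventually_elim (rule sums_summable)
  ultimately show ?thesis
    by blast
qed

end
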